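(* Let $G$ be a connected graph with $n$ vertices and $m$ edges. Then $tmc(G)=m+n-4$ if and only if $G\in\{K_n-P_4,\ K_n-2K_2,\ K_n-K_4,\ K_n-(K_4-K_2),\ K_n-(K_4-P_3),\ K_n-C_4,\ K_n-K_{1,3}\}$.
   Context: All graphs are simple, finite and undirected. A graph is total-colored if all its edges and all its vertices are assigned colors. A path in a total-colored graph is a total monochromatic path if all its edges and all its internal vertices have the same color. A total-coloring is a TMC-coloring if any two vertices are connected by a total monochromatic path. For a connected graph $G$, $tmc(G)$ is the maximum number of colors used in a TMC-coloring of $G$. For a graph $H$, $K_n-H$ denotes the graph obtained from $K_n$ (resp. $K_4$ for $K_4-H$) by deleting the edges of a copy of $H$. $P_k$ is the path on $k$ vertices, $C_4$ the $4$-cycle, $K_{1,3}$ the star with three edges, and $2K_2$ denotes two vertex-disjoint edges. *)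

theory Defs
  imports Main
begin

record 'a ugraph =
  verts :: "'a set"
  edges :: "'a set set"

definition simple_graph :: "'a ugraph \<Rightarrow> bool" where
  "simple_graph G \<longleftrightarrow> finite (verts G) \<and> (\<forall>e \<in> edges G. e \<subseteq> verts G \<and> card e = 2)"

definition is_path :: "'a ugraph \<Rightarrow> 'a \<Rightarrow> 'a list \<Rightarrow> 'a \<Rightarrow> bool" where
  "is_path G u p v \<longleftrightarrow>
     p \<noteq> [] \<and> hd p = u \<and> last p = v \<and> distinct p \<and> set p \<subseteq> verts G \<and>
     (\<forall>i. Suc i < length p \<longrightarrow> {p ! i, p ! Suc i} \<in> edges G)"

definition path_edges :: "'a list \<Rightarrow> 'a set set" where
  "path_edges p = {{p ! i, p ! Suc i} | i. Suc i < length p}"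

definition internal_verts :: "'a list \<Rightarrow> 'a set" where
  "internal_verts p = set (butlast (tl p))"

definition connected_graph :: "'a ugraph \<Rightarrow> bool" where
  "connected_graph G \<longleftrightarrow>
     verts G \<noteq> {} \<and> (\<forall>u \<in> verts G. \<forall>v \<in> verts G. \<exists>p. is_path G u p v)"


text \<open>
  A total-coloring is given by a vertex coloring \<open>cv\<close> and an edge coloring \<open>ce\<close> that draw
  from the same palette, so a vertex and an edge may share a color. No properness condition is
  imposed. Values outside \<open>verts G\<close> and \<open>edges G\<close> are irrelevant.
\<close>

definition total_monochromatic :: "('a \<Rightarrow> nat) \<Rightarrow> ('a set \<Rightarrow> nat) \<Rightarrow> 'a list \<Rightarrow> bool" where
  "total_monochromatic cv ce p \<longleftrightarrow>
     (\<exists>k. (\<forall>e \<in> path_edges p. ce e = k) \<and> (\<forall>x \<in> internal_verts p. cv x = k))"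

definition tmc_coloring :: "'a ugraph \<Rightarrow> ('a \<Rightarrow> nat) \<Rightarrow> ('a set \<Rightarrow> nat) \<Rightarrow> bool" where
  "tmc_coloring G cv ce \<longleftrightarrow>
     (\<forall>u \<in> verts G. \<forall>v \<in> verts G. \<exists>p. is_path G u p v \<and> total_monochromatic cv ce p)"

definition colors_used :: "'a ugraph \<Rightarrow> ('a \<Rightarrow> nat) \<Rightarrow> ('a set \<Rightarrow> nat) \<Rightarrow> nat set" where
  "colors_used G cv ce = cv ` verts G \<union> ce ` edges G"

definition tmc :: "'a ugraph \<Rightarrow> nat" where
  "tmc G = Max {card (colors_used G cv ce) | cv ce. tmc_coloring G cv ce}"

text \<open>For connected simple graphs the maximum is over a nonempty finite set.\<close>

lemma tmc_set_finite:
  assumes "simple_graph G"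
  shows "finite {card (colors_used G cv ce) | cv ce. tmc_coloring G cv ce}"
proof -
  have fin: "finite (verts G)" "finite (edges G)"
    using assms finite_subset[of "edges G" "Pow (verts G)"]
    by (auto simp: simple_graph_def)
  have "card (colors_used G cv ce) \<le> card (verts G) + card (edges G)" for cv ce
    unfolding colors_used_def
    by (rule order.trans[OF card_Un_le]) (intro add_mono card_image_le fin)
  then show ?thesis
    by (auto intro: finite_subset[of _ "{..card (verts G) + card (edges G)}"])
qed

lemma tmc_set_nonempty:
  assumes "connected_graph G"
  shows "{card (colors_used G cv ce) | cv ce. tmc_coloring G cv ce} \<noteq> {}"
proof -
  have "total_monochromatic (\<lambda>_. 0) (\<lambda>_. 0) p" for p :: "'a list"
    unfolding total_monochromatic_def by blast
  then have "tmc_coloring G (\<lambda>_. 0) (\<lambda>_. 0)"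
    using assms by (simp add: connected_graph_def tmc_coloring_def)
  then show ?thesis by blast
qed


definition graph_iso :: "'a ugraph \<Rightarrow> 'b ugraph \<Rightarrow> bool" where
  "graph_iso G H \<longleftrightarrow>
     (\<exists>f. bij_betw f (verts G) (verts H) \<and> edges H = (\<lambda>e. f ` e) ` edges G)"

definition subgraph :: "'a ugraph \<Rightarrow> 'a ugraph \<Rightarrow> bool" where
  "subgraph H G \<longleftrightarrow> simple_graph H \<and> verts H \<subseteq> verts G \<and> edges H \<subseteq> edges G"

definition delete_edges :: "'a ugraph \<Rightarrow> 'a set set \<Rightarrow> 'a ugraph" where
  "delete_edges G F = \<lparr>verts = verts G, edges = edges G - F\<rparr>"

definition complete_graph :: "nat \<Rightarrow> nat ugraph" where
  "complete_graph n = \<lparr>verts = {..<n}, edges = {e. e \<subseteq> {..<n} \<and> card e = 2}\<rparr>"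

definition path_graph :: "nat \<Rightarrow> nat ugraph" where
  "path_graph k = \<lparr>verts = {..<k}, edges = {{i, Suc i} | i. Suc i < k}\<rparr>"

text \<open>Meant for \<open>k \<ge> 3\<close>; for smaller \<open>k\<close> this is not a cycle.\<close>

definition cycle_graph :: "nat \<Rightarrow> nat ugraph" where
  "cycle_graph k = \<lparr>verts = {..<k}, edges = {{i, Suc i mod k} | i. i < k}\<rparr>"

definition star_graph :: "nat \<Rightarrow> nat ugraph" where
  "star_graph k = \<lparr>verts = {..k}, edges = {{0, i} | i. 1 \<le> i \<and> i \<le> k}\<rparr>"

definition two_K2 :: "nat ugraph" where
  "two_K2 = \<lparr>verts = {0, 1, 2, 3}, edges = {{0, 1}, {2, 3}}\<rparr>"

text \<open>
  \<open>complete_minus n H\<close> is the isomorphism class of the graph written $K_n - H$: the graphs (on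
  vertices of any type) isomorphic to \<open>complete_graph n\<close> with the edges of some copy of \<open>H\<close> in it
  deleted. It is empty if \<open>H\<close> has more than \<open>n\<close> vertices, since then there is no copy.
\<close>

definition complete_minus :: "nat \<Rightarrow> nat ugraph \<Rightarrow> 'a ugraph set" where
  "complete_minus n H =
     {G. \<exists>H'. subgraph H' (complete_graph n) \<and> graph_iso H H' \<and>
              graph_iso (delete_edges (complete_graph n) (edges H')) G}"

text \<open>
  \<open>complete_minus_class n \<H>\<close> is $K_n - H$ with \<open>H\<close> itself given as an isomorphism class, as
  needed for iterated deletions such as $K_n - (K_4 - P_3)$.
\<close>

definition complete_minus_class :: "nat \<Rightarrow> nat ugraph set \<Rightarrow> 'a ugraph set" where
  "complete_minus_class n \<H> = (\<Union>H \<in> \<H>. complete_minus n H)"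

end

theory Submission
  imports Defs
begin

text \<open>
  Call a vertex universal if it is adjacent to all others, and let \<open>T\<close> be the set of non-universal
  vertices, i.e. the union of the non-edges. The seven graphs deleted in the theorem are exactly the
  graphs on four vertices without isolated vertices, so the right-hand side says \<open>card T = 4\<close>.

  Every TMC-coloring uses at most \<open>m + n - card T\<close> colors. For a color \<open>k\<close> let \<open>W\<close> and \<open>E\<close> be its
  vertices and edges, and \<open>N\<close> the vertices joined by an edge in \<open>E\<close> to a vertex in \<open>W\<close>. Each
  \<open>x \<in> T\<close> starts a monochromatic path of length at least two, hence lies in some \<open>N\<close>. Moreover
  \<open>card N + 1 \<le> card W + card E\<close> if \<open>N\<close> is nonempty; summing over the colors gives the bound.

  Conversely, a star from a universal vertex to \<open>T\<close>, monochromatic together with its center, loses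
  only \<open>card T\<close> colors. If there is no universal vertex and \<open>n \<le> 4\<close>, then \<open>n = 4\<close> and \<open>G\<close> has a
  Hamiltonian path, which can be used in place of the star.
\<close>

section \<open>Non-edges, and paths as explicit lists\<close>

definition nonedges :: "'a ugraph \<Rightarrow> 'a set set" where
  "nonedges G = {e. e \<subseteq> verts G \<and> card e = 2 \<and> e \<notin> edges G}"

lemma simple_graph_finite:
  assumes "simple_graph G"
  shows "finite (verts G)" "finite (edges G)"
  using assms finite_subset[of "edges G" "Pow (verts G)"] by (auto simp: simple_graph_def)

lemma simple_graph_edgeD:
  assumes "simple_graph G" "{x, y} \<in> edges G"
  shows "x \<in> verts G" "y \<in> verts G" "x \<noteq> y"
  using assms by (force simp: simple_graph_def)+

lemma pair_in_nonedges_iff: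
  "{x, y} \<in> nonedges G \<longleftrightarrow> x \<in> verts G \<and> y \<in> verts G \<and> x \<noteq> y \<and> {x, y} \<notin> edges G"
  by (auto simp: nonedges_def)

lemma Union_nonedges_subset: "\<Union> (nonedges G) \<subseteq> verts G"
  by (auto simp: nonedges_def)

lemma mem_Union_nonedges_iff: "x \<in> \<Union> (nonedges G) \<longleftrightarrow> (\<exists>y. {x, y} \<in> nonedges G)"
proof
  assume "x \<in> \<Union> (nonedges G)"
  then obtain e where e: "e \<in> nonedges G" "x \<in> e" by blast
  then obtain a b where "e = {a, b}" by (auto simp: nonedges_def card_2_iff)
  with e show "\<exists>y. {x, y} \<in> nonedges G" by (metis insert_commute insertE singletonD)
qed blast

text \<open>Replaces the index-based definition by a recursion, so that \<open>simp\<close> can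
  evaluate the edges of a path written out as a list.\<close>

lemma path_edges_simps [simp]:
  "path_edges [] = {}" "path_edges [x] = {}"
  "path_edges (x # y # zs) = insert {x, y} (path_edges (y # zs))"
proof -
  show "path_edges (x # y # zs) = insert {x, y} (path_edges (y # zs))" (is "?L = ?R")
  proof
    show "?L \<subseteq> ?R"
    proof
      fix e assume "e \<in> ?L"
      then obtain i where "Suc i < length (x # y # zs)"
        "e = {(x # y # zs) ! i, (x # y # zs) ! Suc i}" by (auto simp: path_edges_def)
      then show "e \<in> ?R" by (cases i) (auto simp: path_edges_def)
    qed
    show "?R \<subseteq> ?L"
    proof
      fix e assume "e \<in> ?R"
      then consider "e = {x, y}"
        | i where "Suc i < length (y # zs)" "e = {(y # zs) ! i, (y # zs) ! Suc i}"
        by (auto simp: path_edges_def)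
      then show "e \<in> ?L"
      proof cases
        case 1
        then show ?thesis by (auto simp: path_edges_def intro!: exI[of _ 0])
      next
        case (2 i)
        then show ?thesis by (auto simp: path_edges_def intro!: exI[of _ "Suc i"])
      qed
    qed
  qed
qed (auto simp: path_edges_def)

lemma is_path_iff:
  "is_path G u p v \<longleftrightarrow> p \<noteq> [] \<and> hd p = u \<and> last p = v \<and> distinct p \<and> set p \<subseteq> verts G \<and>
     path_edges p \<subseteq> edges G"
  by (auto simp: is_path_def path_edges_def)

text \<open>A one-vertex list would force \<open>u = v\<close>, and a two-vertex list would make
  \<open>{u, v}\<close> an edge. Hence \<open>y\<close> is an internal vertex, and this is where the
  colors of vertices enter.\<close>

lemma is_path_nonedgeE:
  assumes "is_path G u p v" "{u, v} \<in> nonedges G"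
  obtains y z ps where "p = u # y # z # ps"
proof -
  have "u \<noteq> v" using assms(2) unfolding pair_in_nonedges_iff by blast
  from assms obtain qs where p: "p = u # qs"
    by (cases p) (auto simp: is_path_iff)
  with assms \<open>u \<noteq> v\<close> obtain y rs where qs: "qs = y # rs"
    by (cases qs) (auto simp: is_path_iff)
  with p assms obtain z ps where "rs = z # ps"
    by (cases rs) (auto simp: is_path_iff pair_in_nonedges_iff)
  with p qs that show ?thesis by blast
qed

section \<open>Upper bound on the number of colors\<close>

lemma card_colour_class:
  fixes W N :: "'a set" and E :: "'a set set"
  assumes fin: "finite W" "finite E" "finite N" and E2: "\<And>e. e \<in> E \<Longrightarrow> card e = 2"
    and nb: "\<And>x. x \<in> N \<Longrightarrow> \<exists>y \<in> W. {x, y} \<in> E" and "N \<noteq> {}"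
  shows "Suc (card N) \<le> card W + card E"
proof -
  \<comment> \<open>\<open>x \<mapsto> {x, y x}\<close> embeds \<open>N - W\<close> into \<open>E\<close>. The extra 1 comes from a vertex of \<open>W\<close> if \<open>N\<close> and
    \<open>W\<close> are disjoint, and otherwise from an edge inside \<open>W\<close>, which this embedding misses.\<close>
  from nb obtain y where y: "\<And>x. x \<in> N \<Longrightarrow> y x \<in> W \<and> {x, y x} \<in> E" by metis
  define J where "J = (\<lambda>x. {x, y x}) ` (N - W)"
  have "inj_on (\<lambda>x. {x, y x}) (N - W)"
    using y by (auto simp: inj_on_def doubleton_eq_iff)
  then have cJ: "card J = card (N - W)" by (simp add: J_def card_image)
  have JE: "J \<subseteq> E" using y by (auto simp: J_def)
  have cN: "card N = card (N - W) + card (N \<inter> W)"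
    using fin by (metis card_Diff_subset_Int card_mono diff_add finite_Int inf_le1 add.commute)
  show ?thesis
  proof (cases "N \<inter> W = {}")
    case True
    from \<open>N \<noteq> {}\<close> y fin have "card W > 0" by (auto simp: card_gt_0_iff)
    moreover have "card J \<le> card E" using JE fin by (simp add: card_mono)
    ultimately show ?thesis using cJ cN True by simp
  next
    case False
    then obtain x where x: "x \<in> N" "x \<in> W" by blast
    with y have "{x, y x} \<notin> J" unfolding J_def image_iff doubleton_eq_iff by (metis DiffD2)
    moreover have "finite J" using JE fin finite_subset by blast
    ultimately have "Suc (card J) = card (insert {x, y x} J)" by simp
    also have "\<dots> \<le> card E" using JE y x fin by (intro card_mono) auto
    finally have "Suc (card J) \<le> card E" .
    moreover have "card (N \<inter> W) \<le> card W" using fin by (simp add: card_mono)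
    ultimately show ?thesis using cJ cN by simp
  qed
qed

lemma sum_card_fibres:
  assumes "finite A" "finite C" "f ` A \<subseteq> C"
  shows "(\<Sum>k\<in>C. card {x \<in> A. f x = k}) = card A"
  using sum.group[OF assms, of "\<lambda>_. 1 :: nat"] by simp

lemma card_colors_used_le:
  assumes G: "simple_graph G" and col: "tmc_coloring G cv ce"
  shows "card (colors_used G cv ce) + card (\<Union> (nonedges G)) \<le> card (verts G) + card (edges G)"
proof -
  note fin = simple_graph_finite[OF G]
  define C where "C = colors_used G cv ce"
  define W where "W k = {v \<in> verts G. cv v = k}" for k
  define E where "E k = {e \<in> edges G. ce e = k}" for k
  define N where "N k = {x \<in> verts G. \<exists>y \<in> W k. {x, y} \<in> E k}" for k
  have finC: "finite C" using fin by (simp add: C_def colors_used_def)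
  have "\<Union> (nonedges G) \<subseteq> (\<Union>k\<in>C. N k)"
  proof
    fix x assume "x \<in> \<Union> (nonedges G)"
    then obtain v where v: "{x, v} \<in> nonedges G" unfolding mem_Union_nonedges_iff by blast
    with col obtain p where p: "is_path G x p v" "total_monochromatic cv ce p"
      by (auto simp: tmc_coloring_def pair_in_nonedges_iff)
    from p(1) v obtain y z ps where eq: "p = x # y # z # ps" by (rule is_path_nonedgeE)
    \<comment> \<open>The vertex \<open>y\<close> is internal to \<open>p\<close>, so it shares the
      color of the first edge; this puts \<open>x\<close> into \<open>N k\<close>.\<close>
    from p(2) eq obtain k where "ce {x, y} = k" "cv y = k"
      by (auto simp: total_monochromatic_def internal_verts_def)
    with p(1) eq show "x \<in> (\<Union>k\<in>C. N k)"
      by (auto simp: is_path_iff N_def W_def E_def C_def colors_used_def)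
  qed
  then have "card (\<Union> (nonedges G)) \<le> card (\<Union>k\<in>C. N k)"
    using fin finC by (intro card_mono) (auto simp: N_def)
  also have "\<dots> \<le> (\<Sum>k\<in>C. card (N k))" by (rule card_UN_le[OF finC])
  \<comment> \<open>The summand \<open>card C\<close> is spread as one unit per color, which
    produces the \<open>Suc\<close>.\<close>
  finally have "card C + card (\<Union> (nonedges G)) \<le> (\<Sum>k\<in>C. Suc (card (N k)))"
    by (simp add: sum.distrib sum_Suc)
  also have "\<dots> \<le> (\<Sum>k\<in>C. card (W k) + card (E k))"
  proof (rule sum_mono)
    fix k assume k: "k \<in> C"
    have f: "finite (W k)" "finite (E k)" "finite (N k)"
      using fin by (auto simp: W_def E_def N_def)
    show "Suc (card (N k)) \<le> card (W k) + card (E k)"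
    proof (cases "N k = {}")
      case True
      \<comment> \<open>With \<open>N k\<close> empty only one unit has to be paid for, and a color
        in \<open>C\<close> occurs on some vertex or edge.\<close>
      from k have "W k \<noteq> {} \<or> E k \<noteq> {}"
        by (auto simp: C_def colors_used_def W_def E_def)
      with f have "card (W k) > 0 \<or> card (E k) > 0" by (simp add: card_gt_0_iff)
      with True show ?thesis by auto
    next
      case False
      show ?thesis
        by (rule card_colour_class[OF f _ _ False])
          (use G in \<open>auto simp: N_def E_def simple_graph_def\<close>)
    qed
  qed
  also have "\<dots> = card (verts G) + card (edges G)"
    unfolding sum.distrib W_def E_def using fin finC
    by (subst (1 2) sum_card_fibres) (auto simp: C_def colors_used_def)
  finally show ?thesis by (simp add: C_def)
qed

section \<open>Lower bounds from explicit colorings\<close>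

text \<open>Merge \<open>S\<close> and \<open>F\<close> into one color and give every other vertex
  and edge a color of its own. Equal or adjacent vertices are joined by a path without internal
  vertices and with at most one edge, so only non-edges require monochromatic paths inside the
  merged class.\<close>

lemma tmc_ge_uncollapsed:
  assumes G: "simple_graph G" and S: "S \<subseteq> verts G" "S \<noteq> {}" and F: "F \<subseteq> edges G"
    and paths: "\<And>u v. {u, v} \<in> nonedges G \<Longrightarrow>
      \<exists>p. is_path G u p v \<and> path_edges p \<subseteq> F \<and> internal_verts p \<subseteq> S"
  shows "card (verts G) + card (edges G) + 1 \<le> tmc G + card S + card F"
proof -
  note fin = simple_graph_finite[OF G]
  obtain h where h: "bij_betw h (verts G) {0..<card (verts G)}"
    using ex_bij_betw_finite_nat[OF fin(1)] by blast
  obtain h' where h': "bij_betw h' (edges G) {0..<card (edges G)}"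
    using ex_bij_betw_finite_nat[OF fin(2)] by blast
  \<comment> \<open>Color 0 is reserved for the merged class. The \<open>Suc\<close> keeps the other
    colors positive, and the offset \<open>card (verts G)\<close> separates edge colors from vertex
    colors.\<close>
  define cv where "cv v = (if v \<in> S then 0 else Suc (h v))" for v
  define ce where "ce e = (if e \<in> F then 0 else Suc (card (verts G) + h' e))" for e
  have "tmc_coloring G cv ce"
    unfolding tmc_coloring_def
  proof (intro ballI)
    fix u v assume uv: "u \<in> verts G" "v \<in> verts G"
    consider "u = v" | "u \<noteq> v" "{u, v} \<in> edges G" | "{u, v} \<in> nonedges G"
      using uv by (auto simp: pair_in_nonedges_iff)
    then show "\<exists>p. is_path G u p v \<and> total_monochromatic cv ce p"
    proof cases
      case 1
      then show ?thesis using uv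
        by (intro exI[of _ "[u]"]) (auto simp: is_path_iff total_monochromatic_def internal_verts_def)
    next
      case 2
      then show ?thesis using uv
        by (intro exI[of _ "[u, v]"])
          (auto simp: is_path_iff total_monochromatic_def internal_verts_def)
    next
      case 3
      from paths[OF this] obtain p where p: "is_path G u p v" "path_edges p \<subseteq> F" "internal_verts p \<subseteq> S"
        by blast
      then have "total_monochromatic cv ce p"
        unfolding total_monochromatic_def by (intro exI[of _ 0]) (auto simp: cv_def ce_def)
      with p show ?thesis by blast
    qed
  qed
  then have "card (colors_used G cv ce) \<le> tmc G"
    unfolding tmc_def by (intro Max_ge tmc_set_finite[OF G]) blast
  moreover have "card (verts G) + card (edges G) + 1 \<le> card (colors_used G cv ce) + card S + card F"
  proof -
    let ?A = "cv ` (verts G - S)" and ?B = "ce ` (edges G - F)"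
    have "inj_on cv (verts G - S)"
      using h by (auto simp: inj_on_def cv_def bij_betw_def)
    then have cA: "card ?A = card (verts G) - card S"
      using S fin by (simp add: card_image card_Diff_subset finite_subset)
    have "inj_on ce (edges G - F)"
      using h' by (auto simp: inj_on_def ce_def bij_betw_def)
    then have cB: "card ?B = card (edges G) - card F"
      using F fin by (simp add: card_image card_Diff_subset finite_subset)
    have "h v < card (verts G)" if "v \<in> verts G" for v
      using h that by (auto simp: bij_betw_def)
    then have disj: "?A \<inter> ?B = {}" by (force simp: cv_def ce_def)
    have "card (insert 0 (?A \<union> ?B)) = Suc (card ?A + card ?B)"
      using fin disj by (subst card_insert_disjoint) (auto simp: card_Un_disjoint cv_def ce_def)
    moreover have "insert 0 (?A \<union> ?B) \<subseteq> colors_used G cv ce"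
      using S by (auto simp: colors_used_def cv_def)
    then have "card (insert 0 (?A \<union> ?B)) \<le> card (colors_used G cv ce)"
      using fin by (intro card_mono) (auto simp: colors_used_def)
    ultimately show ?thesis using cA cB by linarith
  qed
  ultimately show ?thesis by linarith
qed

lemma tmc_le:
  assumes "simple_graph G" "connected_graph G"
  shows "tmc G + card (\<Union> (nonedges G)) \<le> card (verts G) + card (edges G)"
proof -
  have "tmc G \<in> {card (colors_used G cv ce) | cv ce. tmc_coloring G cv ce}"
    unfolding tmc_def using assms by (intro Max_in tmc_set_finite tmc_set_nonempty)
  then show ?thesis using card_colors_used_le[OF assms(1)] by auto
qed

text \<open>Two non-adjacent vertices both lie in \<open>\<Union> (nonedges G)\<close> and are
  joined through \<open>c\<close>. Merging \<open>{c}\<close> with the star edges gives the bound,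
  the center paying for the extra 1 in \<open>tmc_ge_uncollapsed\<close>.\<close>

lemma tmc_ge_universal:
  assumes G: "simple_graph G" and c: "c \<in> verts G" "c \<notin> \<Union> (nonedges G)"
  shows "card (verts G) + card (edges G) \<le> tmc G + card (\<Union> (nonedges G))"
proof -
  let ?T = "\<Union> (nonedges G)" and ?F = "(\<lambda>x. {c, x}) ` \<Union> (nonedges G)"
  have edge: "{c, x} \<in> edges G" if "x \<in> ?T" for x
  proof -
    have "x \<in> verts G" "x \<noteq> c" using that c Union_nonedges_subset[of G] by auto
    then show ?thesis using c pair_in_nonedges_iff[of c x G] by blast
  qed
  have "card (verts G) + card (edges G) + 1 \<le> tmc G + card {c} + card ?F"
  proof (rule tmc_ge_uncollapsed[OF G])
    fix u v assume uv: "{u, v} \<in> nonedges G"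
    then have T: "u \<in> ?T" "v \<in> ?T" by auto
    with c uv have "is_path G u [u, c, v] v"
      using edge[OF T(1)] edge[OF T(2)] by (auto simp: is_path_iff pair_in_nonedges_iff insert_commute)
    moreover have "path_edges [u, c, v] \<subseteq> ?F" using T by (auto simp: insert_commute)
    ultimately show "\<exists>p. is_path G u p v \<and> path_edges p \<subseteq> ?F \<and> internal_verts p \<subseteq> {c}"
      by (intro exI[of _ "[u, c, v]"]) (simp add: internal_verts_def)
  qed (use c edge in auto)
  moreover have "card ?F \<le> card ?T"
    using simple_graph_finite(1)[OF G] Union_nonedges_subset[of G]
    by (intro card_image_le) (rule finite_subset)
  ultimately show ?thesis by simp
qed

text \<open>A path between non-adjacent vertices has at least three vertices. If it has four, it is
  Hamiltonian. Otherwise its midpoint misses some fourth vertex, which by connectedness is adjacent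
  to one of the two ends and extends the path there.\<close>

lemma hamiltonian_path_if_no_universal:
  assumes G: "simple_graph G" "connected_graph G" and T: "\<Union> (nonedges G) = verts G"
    and n: "card (verts G) \<le> 4"
  obtains a b c d where "distinct [a, b, c, d]" "verts G = {a, b, c, d}"
    "{a, b} \<in> edges G" "{b, c} \<in> edges G" "{c, d} \<in> edges G"
proof -
  note fin = simple_graph_finite[OF G(1)]
  have path: "\<exists>p. is_path G x p y" if "{x, y} \<in> nonedges G" for x y
    using G(2) that by (auto simp: connected_graph_def pair_in_nonedges_iff)
  from G(2) T obtain u where "u \<in> \<Union> (nonedges G)" by (auto simp: connected_graph_def)
  then obtain v where uv: "{u, v} \<in> nonedges G" unfolding mem_Union_nonedges_iff by blast
  with path obtain p where p: "is_path G u p v" by blast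
  from p uv obtain y z ps where eq: "p = u # y # z # ps" by (rule is_path_nonedgeE)
  have dist: "distinct p" and sub: "set p \<subseteq> verts G" using p by (auto simp: is_path_iff)
  have len: "length p \<le> card (verts G)"
    using card_mono[OF fin(1) sub] distinct_card[OF dist] by simp
  show thesis
  proof (cases ps)
    case (Cons d qs)
    with eq len have "4 + length qs \<le> card (verts G)" by simp
    with n have "length qs = 0" by linarith
    then have qs: "qs = []" by simp
    with dist sub eq Cons n fin have "set p = verts G"
      by (intro card_seteq) (auto simp: distinct_card)
    with Cons eq qs p show thesis
      by (intro that[of u y z d]) (auto simp: is_path_iff)
  next
    case Nil
    with p eq have zv: "z = v" by (simp add: is_path_iff)
    have e: "{u, y} \<in> edges G" "{y, v} \<in> edges G" "distinct [u, y, v]"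
      "{u, y, v} \<subseteq> verts G"
      using p eq Nil zv by (auto simp: is_path_iff)
    \<comment> \<open>The midpoint \<open>y\<close> is not universal. Since it is adjacent to
      \<open>u\<close> and \<open>v\<close>, its non-neighbor \<open>x\<close> is new.\<close>
    with T obtain x where x: "{y, x} \<in> nonedges G" using mem_Union_nonedges_iff by fastforce
    then have xd: "x \<in> verts G" "x \<notin> {u, y, v}"
      using e by (auto simp: pair_in_nonedges_iff insert_commute)
    have V: "verts G = {u, y, v, x}"
      using e xd n fin by (intro card_seteq[symmetric]) auto
    from x have x': "{x, y} \<in> nonedges G" by (simp add: insert_commute)
    with path obtain q where q: "is_path G x q y" by blast
    from q x' obtain w z' ps' where "q = x # w # z' # ps'" by (rule is_path_nonedgeE)
    with q have "{x, w} \<in> edges G" by (simp add: is_path_iff)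
    \<comment> \<open>The neighbor \<open>w\<close> of \<open>x\<close> is neither \<open>x\<close>
      nor \<open>y\<close>, so only the ends \<open>u\<close> and \<open>v\<close> remain.\<close>
    with x' have "{x, u} \<in> edges G \<or> {x, v} \<in> edges G"
      using V simple_graph_edgeD[OF G(1), of x w] by (auto simp: pair_in_nonedges_iff)
    then show thesis
    proof
      assume "{x, u} \<in> edges G"
      with e xd V show thesis by (intro that[of x u y v]) auto
    next
      assume "{x, v} \<in> edges G"
      with e xd V show thesis by (intro that[of x v y u]) (auto simp: insert_commute)
    qed
  qed
qed

text \<open>The merged class consists of the two internal vertices and the three edges of the path:
  five elements in one color, a loss of four.\<close>

lemma tmc_ge_hamiltonian:
  assumes G: "simple_graph G" and d: "distinct [a, b, c, d]" and V: "verts G = {a, b, c, d}"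
    and e: "{a, b} \<in> edges G" "{b, c} \<in> edges G" "{c, d} \<in> edges G"
  shows "card (verts G) + card (edges G) \<le> tmc G + 4"
proof -
  let ?S = "{b, c}" and ?F = "{{a, b}, {b, c}, {c, d}}"
  have "card (verts G) + card (edges G) + 1 \<le> tmc G + card ?S + card ?F"
  proof (rule tmc_ge_uncollapsed[OF G])
    fix u v assume uv: "{u, v} \<in> nonedges G"
    \<comment> \<open>Each of these six ordered pairs is joined by a segment of the path, read in
      one of its two directions.\<close>
    have "(u, v) \<in> {(a, c), (a, d), (b, d), (c, a), (d, a), (d, b)}"
      using uv e V by (auto simp: pair_in_nonedges_iff insert_commute)
    then show "\<exists>p. is_path G u p v \<and> path_edges p \<subseteq> ?F \<and> internal_verts p \<subseteq> ?S"
      using d e V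
      by (elim insertE emptyE)
        ((intro exI[of _ "[a, b, c]"], force simp: is_path_iff internal_verts_def insert_commute)
        | (intro exI[of _ "[a, b, c, d]"], force simp: is_path_iff internal_verts_def insert_commute)
        | (intro exI[of _ "[b, c, d]"], force simp: is_path_iff internal_verts_def insert_commute)
        | (intro exI[of _ "[c, b, a]"], force simp: is_path_iff internal_verts_def insert_commute)
        | (intro exI[of _ "[d, c, b, a]"], force simp: is_path_iff internal_verts_def insert_commute)
        | (intro exI[of _ "[d, c, b]"], force simp: is_path_iff internal_verts_def insert_commute))+
  qed (use V e in auto)
  moreover have "card ?S = 2" using d by simp
  moreover have "card ?F \<le> 3" by (simp add: card_insert_if)
  ultimately show ?thesis by simp
qed

lemma tmc_eq_iff_card_nonuniversal:
  assumes G: "simple_graph G" "connected_graph G"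
  shows "tmc G + 4 = card (verts G) + card (edges G) \<longleftrightarrow> card (\<Union> (nonedges G)) = 4"
proof -
  let ?T = "\<Union> (nonedges G)"
  \<comment> \<open>Either side of the equivalence forces \<open>card ?T \<le> 4\<close>: the left
    one by \<open>tmc_le\<close>, the right one trivially. In that range upper and lower bound
    coincide.\<close>
  have "card (verts G) + card (edges G) \<le> tmc G + card ?T" if le: "card ?T \<le> 4"
  proof (cases "?T = verts G")
    case False
    with Union_nonedges_subset[of G] obtain c where "c \<in> verts G" "c \<notin> ?T" by blast
    then show ?thesis by (rule tmc_ge_universal[OF G(1)])
  next
    case True
    with le have "card (verts G) \<le> 4" by simp
    from G True this obtain a b c d where h: "distinct [a, b, c, d]" "verts G = {a, b, c, d}"
      "{a, b} \<in> edges G" "{b, c} \<in> edges G" "{c, d} \<in> edges G"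
      by (rule hamiltonian_path_if_no_universal)
    then have "card ?T = 4" unfolding True by simp
    with tmc_ge_hamiltonian[OF G(1) h] show ?thesis by simp
  qed
  then show ?thesis using tmc_le[OF G] by linarith
qed

section \<open>The classes \<open>complete_minus n H\<close> in terms of non-edges\<close>

text \<open>An isomorphism from the complete graph minus the copy of \<open>H\<close> onto
  \<open>G\<close> maps the deleted edges exactly onto the non-edges. Composing it with the map from
  \<open>H\<close> to its copy gives \<open>f\<close>.\<close>

lemma complete_minusE:
  assumes "G \<in> complete_minus n H"
  obtains f where "inj_on f (verts H)" "f ` verts H \<subseteq> verts G"
    "nonedges G = (\<lambda>e. f ` e) ` edges H" "card (verts G) = n" "simple_graph G"
proof -
  from assms obtain H' f g where
    sub: "subgraph H' (complete_graph n)"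
    and f: "bij_betw f (verts H) (verts H')" "edges H' = (\<lambda>e. f ` e) ` edges H"
    and g: "bij_betw g {..<n} (verts G)"
      "edges G = (\<lambda>e. g ` e) ` ({e. e \<subseteq> {..<n} \<and> card e = 2} - edges H')"
    by (auto simp: complete_minus_def graph_iso_def delete_edges_def complete_graph_def)
  have inj: "inj_on g {..<n}" and img: "g ` {..<n} = verts G"
    using g by (auto simp: bij_betw_def)
  have H': "verts H' \<subseteq> {..<n}" "edges H' \<subseteq> {e. e \<subseteq> {..<n} \<and> card e = 2}"
    using sub by (auto simp: subgraph_def complete_graph_def)
  have pairs: "{e. e \<subseteq> verts G \<and> card e = 2} = (\<lambda>e. g ` e) ` {e. e \<subseteq> {..<n} \<and> card e = 2}"
  proof (intro equalityI subsetI)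
    fix e assume "e \<in> {e. e \<subseteq> verts G \<and> card e = 2}"
    then obtain e' where e': "e' \<subseteq> {..<n}" "e = g ` e'" "card e = 2"
      using img by (metis (mono_tags, lifting) mem_Collect_eq subset_image_iff)
    then have "card e' = 2" using inj card_image inj_on_subset by metis
    with e' show "e \<in> (\<lambda>e. g ` e) ` {e. e \<subseteq> {..<n} \<and> card e = 2}" by blast
  next
    fix e assume "e \<in> (\<lambda>e. g ` e) ` {e. e \<subseteq> {..<n} \<and> card e = 2}"
    then show "e \<in> {e. e \<subseteq> verts G \<and> card e = 2}"
      using img inj by (auto simp: card_image inj_on_subset)
  qed
  \<comment> \<open>Needed so that taking images of edges commutes with set difference.\<close>
  have injP: "inj_on (\<lambda>e. g ` e) {e. e \<subseteq> {..<n} \<and> card e = 2}"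
    by (rule inj_on_subset[OF inj_on_image_Pow[OF inj]]) auto
  show thesis
  proof
    show "inj_on (g \<circ> f) (verts H)"
      using f H' inj by (auto simp: bij_betw_def intro!: comp_inj_on inj_on_subset[OF inj])
    have "(g \<circ> f) ` verts H = g ` verts H'"
      unfolding image_comp[symmetric] using f by (simp add: bij_betw_def)
    then show "(g \<circ> f) ` verts H \<subseteq> verts G" using H'(1) img by blast
    have "nonedges G = {e. e \<subseteq> verts G \<and> card e = 2} - edges G" by (auto simp: nonedges_def)
    also have "\<dots> = (\<lambda>e. g ` e) ` ({e. e \<subseteq> {..<n} \<and> card e = 2} - ({e. e \<subseteq> {..<n} \<and> card e = 2} - edges H'))"
      unfolding pairs g(2) by (rule inj_on_image_set_diff[OF injP, symmetric]) auto
    also have "\<dots> = (\<lambda>e. g ` e) ` edges H'" by (simp only: double_diff[OF H'(2) subset_refl])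
    finally show "nonedges G = (\<lambda>e. (g \<circ> f) ` e) ` edges H"
      by (simp add: f(2) image_image image_comp)
    show "card (verts G) = n" using img inj by (metis card_image card_lessThan)
    have "edges G \<subseteq> {e. e \<subseteq> verts G \<and> card e = 2}" unfolding pairs g(2) by blast
    moreover have "finite (verts G)" by (metis img finite_imageI finite_lessThan)
    ultimately show "simple_graph G" by (auto simp: simple_graph_def)
  qed
qed

text \<open>Converse of \<open>complete_minusE\<close>: number the vertices of \<open>G\<close> by
  \<open>h\<close>; the numbered non-edges form the copy of \<open>H\<close> to delete, and the
  inverse of \<open>h\<close> is the isomorphism onto \<open>G\<close>.\<close>

lemma complete_minusI:
  assumes G: "simple_graph G" and n: "card (verts G) = n" and fin: "finite (verts H)"
    and f: "inj_on f (verts H)" "f ` verts H \<subseteq> verts G"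
    and N: "nonedges G = (\<lambda>e. f ` e) ` edges H" and H: "\<And>e. e \<in> edges H \<Longrightarrow> e \<subseteq> verts H"
  shows "G \<in> complete_minus n H"
proof -
  obtain h where h: "bij_betw h (verts G) {..<n}"
    using ex_bij_betw_finite_nat[OF simple_graph_finite(1)[OF G]] n
    by (auto simp: atLeast0LessThan)
  define g where "g = inv_into (verts G) h"
  have g: "bij_betw g {..<n} (verts G)" unfolding g_def by (rule bij_betw_inv_into[OF h])
  have hi: "inj_on h (verts G)" "h ` verts G = {..<n}" using h by (auto simp: bij_betw_def)
  have gh: "g ` h ` e = e" if "e \<subseteq> verts G" for e
    using that hi by (simp add: g_def inv_into_image_cancel)
  have hg: "h ` g ` e = e" if "e \<subseteq> {..<n}" for e
    using that hi by (simp add: g_def image_inv_into_cancel)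
  have hc: "card (h ` e) = card e" if "e \<subseteq> verts G" for e
    using that hi by (auto intro: card_image inj_on_subset)
  have hv: "h v < n" if "v \<in> verts G" for v using that hi by auto
  then have hs: "h ` e \<subseteq> {..<n}" if "e \<subseteq> verts G" for e using that by auto
  \<comment> \<open>The vertices come from \<open>H\<close> rather than from the non-edges, so that
    isolated vertices of \<open>H\<close> keep an image.\<close>
  define H' where "H' = \<lparr>verts = h ` f ` verts H, edges = (\<lambda>e. h ` e) ` nonedges G\<rparr>"
  have Ns: "e \<subseteq> verts G" "card e = 2" "e \<notin> edges G" if "e \<in> nonedges G" for e
    using that by (auto simp: nonedges_def)
  have hN: "h ` e \<subseteq> h ` f ` verts H" "h ` e \<subseteq> {..<n}" "card (h ` e) = 2"
    if "e \<in> nonedges G" for e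
  proof -
    from that N obtain d where "d \<in> edges H" "e = f ` d" by blast
    then show "h ` e \<subseteq> h ` f ` verts H" using H by blast
    show "h ` e \<subseteq> {..<n}" "card (h ` e) = 2" using Ns[OF that] hs hc by simp_all
  qed
  then have "subgraph H' (complete_graph n)"
    unfolding subgraph_def simple_graph_def complete_graph_def H'_def ugraph.simps
    using fin hs[OF f(2)] by blast
  moreover have "graph_iso H H'"
    unfolding graph_iso_def
    using f hi
    by (intro exI[of _ "h \<circ> f"])
      (auto simp: H'_def N bij_betw_def image_image image_comp intro!: comp_inj_on inj_on_subset[OF hi(1)])
  moreover have "graph_iso (delete_edges (complete_graph n) (edges H')) G"
  proof -
    have "edges G = (\<lambda>e. g ` e) ` ({e. e \<subseteq> {..<n} \<and> card e = 2} - (\<lambda>e. h ` e) ` nonedges G)"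
    proof (intro equalityI subsetI)
      fix e assume e: "e \<in> edges G"
      then have e': "e \<subseteq> verts G" "card e = 2" using G by (auto simp: simple_graph_def)
      have "h ` e \<notin> (\<lambda>e. h ` e) ` nonedges G"
        using e e' Ns gh by (metis imageE)
      with e' hs hc have "h ` e \<in> {e. e \<subseteq> {..<n} \<and> card e = 2} - (\<lambda>e. h ` e) ` nonedges G" by auto
      then show "e \<in> (\<lambda>e. g ` e) ` ({e. e \<subseteq> {..<n} \<and> card e = 2} - (\<lambda>e. h ` e) ` nonedges G)"
        using gh[OF e'(1)] by (metis imageI)
    next
      fix e assume "e \<in> (\<lambda>e. g ` e) ` ({e. e \<subseteq> {..<n} \<and> card e = 2} - (\<lambda>e. h ` e) ` nonedges G)"
      then obtain d where d: "e = g ` d" "d \<subseteq> {..<n}" "card d = 2" "d \<notin> (\<lambda>e. h ` e) ` nonedges G"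
        by blast
      have "h ` e = d" using d hg by simp
      moreover have es: "e \<subseteq> verts G" using d(1,2) g unfolding bij_betw_def by blast
      ultimately have "card e = 2" "e \<notin> nonedges G" using d(3,4) hc[of e] by auto
      with es show "e \<in> edges G" by (auto simp: nonedges_def)
    qed
    then show ?thesis
      using g by (auto simp: graph_iso_def delete_edges_def complete_graph_def H'_def)
  qed
  ultimately show ?thesis by (auto simp: complete_minus_def)
qed

lemma card_Union_nonedges_complete_minus:
  assumes "G \<in> complete_minus n H" "\<Union> (edges H) = verts H"
  shows "card (\<Union> (nonedges G)) = card (verts H)"
proof -
  from assms(1) obtain f where f: "inj_on f (verts H)" "nonedges G = (\<lambda>e. f ` e) ` edges H"
    by (rule complete_minusE)
  then have "\<Union> (nonedges G) = f ` verts H" by (simp add: assms(2)[symmetric] image_Union)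
  then show ?thesis using f(1) by (simp add: card_image)
qed

text \<open>An isolated vertex would have lost all three of its edges, but at most two were deleted.
  This treats every representative of \<open>K_4 - K_2\<close> and \<open>K_4 - P_3\<close> at
  once.\<close>

lemma Union_edges_complete_minus_4:
  assumes "H \<in> complete_minus 4 K" "finite (edges K)" "card (edges K) \<le> 2"
  shows "\<Union> (edges H) = verts H" "card (verts H) = 4"
proof -
  from assms(1) obtain f where f: "nonedges H = (\<lambda>e. f ` e) ` edges K"
    and H: "card (verts H) = 4" "simple_graph H"
    by (rule complete_minusE)
  show "card (verts H) = 4" by fact
  have "finite (nonedges H)" "card (nonedges H) \<le> 2"
    using assms(2,3) card_image_le[OF assms(2), of "\<lambda>e. f ` e"] by (auto simp: f)
  moreover have "x \<in> \<Union> (edges H)" if x: "x \<in> verts H" for x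
  proof (rule ccontr)
    assume nx: "x \<notin> \<Union> (edges H)"
    have "card (verts H - {x}) = 3" using H x by simp
    moreover have "inj_on (\<lambda>y. {x, y}) (verts H - {x})" by (auto simp: inj_on_def doubleton_eq_iff)
    ultimately have "card ((\<lambda>y. {x, y}) ` (verts H - {x})) = 3" by (simp add: card_image)
    moreover have "(\<lambda>y. {x, y}) ` (verts H - {x}) \<subseteq> nonedges H"
      using nx x by (auto simp: pair_in_nonedges_iff)
    ultimately have "3 \<le> card (nonedges H)" using \<open>finite (nonedges H)\<close> card_mono by metis
    then show False using \<open>card (nonedges H) \<le> 2\<close> by simp
  qed
  ultimately show "\<Union> (edges H) = verts H"
    using H(2) by (auto simp: simple_graph_def)
qed

section \<open>The small graphs written out\<close>

lemma pairs_of_four: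
  assumes "distinct [a, b, c, d]"
  shows "{e. e \<subseteq> {a, b, c, d} \<and> card e = 2} = {{a, b}, {a, c}, {a, d}, {b, c}, {b, d}, {c, d}}"
    (is "?L = ?R")
proof
  show "?L \<subseteq> ?R"
  proof
    fix e assume "e \<in> ?L"
    then have "card e = 2" and sub: "e \<subseteq> {a, b, c, d}" by simp_all
    then obtain x y where e: "e = {x, y}" "x \<noteq> y" unfolding card_2_iff by blast
    with sub have "x \<in> {a, b, c, d}" "y \<in> {a, b, c, d}" by simp_all
    with e(2) show "e \<in> ?R" unfolding e(1) by (elim insertE emptyE) (simp_all add: insert_commute)
  qed
qed (use assms in simp)

lemma lessThan_4: "{..<4} = {0, 1, 2, 3 :: nat}"
  by (simp add: numeral_eq_Suc lessThan_Suc insert_commute)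

lemma complete_graph_4:
  "verts (complete_graph 4) = {0, 1, 2, 3}"
  "edges (complete_graph 4) = {{0, 1}, {0, 2}, {0, 3}, {1, 2}, {1, 3}, {2, 3}}"
  unfolding complete_graph_def ugraph.simps lessThan_4 by (simp_all add: pairs_of_four)

lemma complete_graph_2:
  "verts (complete_graph 2) = {0, 1}" "edges (complete_graph 2) = {{0, 1}}"
proof -
  have eq: "{..<2} = {0, 1 :: nat}" by (simp add: numeral_eq_Suc lessThan_Suc insert_commute)
  show "verts (complete_graph 2) = {0, 1}" by (simp add: complete_graph_def eq)
  have "{e. e \<subseteq> {0, 1 :: nat} \<and> card e = 2} = {{0, 1}}"
  proof (intro equalityI subsetI)
    fix e assume "e \<in> {e. e \<subseteq> {0, 1 :: nat} \<and> card e = 2}"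
    then show "e \<in> {{0, 1}}" using card_subset_eq[of "{0, 1}" e] by simp
  qed simp
  then show "edges (complete_graph 2) = {{0, 1}}" by (simp add: complete_graph_def eq)
qed

lemma path_graph_4:
  "verts (path_graph 4) = {0, 1, 2, 3}" "edges (path_graph 4) = {{0, 1}, {1, 2}, {2, 3}}"
proof -
  have "{i. Suc i < 4} = {0, 1, 2}" by auto
  then have "edges (path_graph 4) = (\<lambda>i. {i, Suc i}) ` {0, 1, 2}"
    by (simp only: path_graph_def ugraph.simps setcompr_eq_image)
  then show "edges (path_graph 4) = {{0, 1}, {1, 2}, {2, 3}}" by (simp add: numeral_eq_Suc)
qed (simp add: path_graph_def lessThan_4)

lemma path_graph_3:
  "verts (path_graph 3) = {0, 1, 2}" "edges (path_graph 3) = {{0, 1}, {1, 2}}"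
proof -
  have "{i. Suc i < 3} = {0, 1}" by auto
  then have "edges (path_graph 3) = (\<lambda>i. {i, Suc i}) ` {0, 1}"
    by (simp only: path_graph_def ugraph.simps setcompr_eq_image)
  then show "edges (path_graph 3) = {{0, 1}, {1, 2}}" by (simp add: numeral_eq_Suc)
qed (simp add: path_graph_def numeral_eq_Suc lessThan_Suc insert_commute)

lemma cycle_graph_4:
  "verts (cycle_graph 4) = {0, 1, 2, 3}" "edges (cycle_graph 4) = {{0, 1}, {1, 2}, {2, 3}, {3, 0}}"
proof -
  have "edges (cycle_graph 4) = (\<lambda>i. {i, Suc i mod 4}) ` {0, 1, 2, 3}"
    unfolding cycle_graph_def lessThan_4[symmetric] lessThan_def
    by (simp only: ugraph.simps setcompr_eq_image)
  moreover have "Suc 0 mod 4 = 1" "Suc 1 mod 4 = 2" "Suc 2 mod 4 = 3" "Suc 3 mod 4 = 0"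
    by simp_all
  ultimately show "edges (cycle_graph 4) = {{0, 1}, {1, 2}, {2, 3}, {3, 0}}"
    by (simp only: image_insert image_empty)
qed (simp add: cycle_graph_def lessThan_4)

lemma star_graph_3:
  "verts (star_graph 3) = {0, 1, 2, 3}" "edges (star_graph 3) = {{0, 1}, {0, 2}, {0, 3}}"
proof -
  have "{i. 1 \<le> i \<and> i \<le> 3} = {1, 2, 3 :: nat}"
    unfolding set_eq_iff mem_Collect_eq insert_iff empty_iff by presburger
  then have "edges (star_graph 3) = (\<lambda>i. {0, i}) ` {1, 2, 3}"
    by (simp only: star_graph_def ugraph.simps setcompr_eq_image)
  then show "edges (star_graph 3) = {{0, 1}, {0, 2}, {0, 3}}" by simp
  show "verts (star_graph 3) = {0, 1, 2, 3}"
    by (simp add: star_graph_def numeral_eq_Suc atMost_Suc insert_commute)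
qed

definition diamond :: "nat ugraph" where
  "diamond = \<lparr>verts = {0, 1, 2, 3}, edges = {{0, 2}, {0, 3}, {1, 2}, {1, 3}, {2, 3}}\<rparr>"

definition paw :: "nat ugraph" where
  "paw = \<lparr>verts = {0, 1, 2, 3}, edges = {{0, 2}, {0, 3}, {1, 3}, {2, 3}}\<rparr>"

lemma nonedges_verts_four:
  assumes "verts H = {0, 1, 2, 3 :: nat}"
  shows "nonedges H = {{0, 1}, {0, 2}, {0, 3}, {1, 2}, {1, 3}, {2, 3}} - edges H"
proof -
  have "nonedges H = {e. e \<subseteq> {0, 1, 2, 3} \<and> card e = 2} - edges H"
    unfolding nonedges_def assms set_diff_eq mem_Collect_eq conj_assoc ..
  moreover have "distinct [0, 1, 2, 3 :: nat]" by simp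
  ultimately show ?thesis by (simp only: pairs_of_four)
qed

lemma diamond_in: "diamond \<in> complete_minus 4 (complete_graph 2)"
proof (rule complete_minusI[where f = id])
  show "nonedges diamond = (\<lambda>e. id ` e) ` edges (complete_graph 2)"
    by (simp add: nonedges_verts_four diamond_def complete_graph_2 doubleton_eq_iff insert_Diff_if)
qed (auto simp: diamond_def simple_graph_def complete_graph_2)

lemma paw_in: "paw \<in> complete_minus 4 (path_graph 3)"
proof (rule complete_minusI[where f = id])
  show "nonedges paw = (\<lambda>e. id ` e) ` edges (path_graph 3)"
    by (simp add: nonedges_verts_four paw_def path_graph_3 doubleton_eq_iff insert_Diff_if)
qed (auto simp: paw_def simple_graph_def path_graph_3)

section \<open>Classification of the non-edges on four vertices\<close>

text \<open>List lookup serves as the embedding of \<open>{0, 1, 2, 3}\<close>, so the condition on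
  the non-edges becomes an equation between explicit sets.\<close>

lemma complete_minus_if_labelled:
  assumes "simple_graph G" and d: "distinct [w, x, y, z]" and sub: "{w, x, y, z} \<subseteq> verts G"
    and H: "verts H = {0, 1, 2, 3}" "\<Union> (edges H) \<subseteq> {0, 1, 2, 3}"
    and N: "nonedges G = (\<lambda>e. (!) [w, x, y, z] ` e) ` edges H"
  shows "G \<in> complete_minus (card (verts G)) H"
proof (rule complete_minusI[OF assms(1) refl _ _ _ N])
  show "inj_on ((!) [w, x, y, z]) (verts H)" using d by (auto simp: H inj_on_def)
qed (use H sub in auto)

text \<open>The non-edges form a graph on four vertices without isolated vertices. If it has a
  perfect matching, the other four pairs leave sixteen cases, covering all types but the star;
  without a perfect matching it is a star.\<close>

lemma complete_minus_if_four_nonuniversal: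
  assumes G: "simple_graph G" and T: "card (\<Union> (nonedges G)) = 4" and n: "n = card (verts G)"
  shows "G \<in> complete_minus n (path_graph 4)
      \<union> complete_minus n two_K2
      \<union> complete_minus n (complete_graph 4)
      \<union> complete_minus_class n (complete_minus 4 (complete_graph 2))
      \<union> complete_minus_class n (complete_minus 4 (path_graph 3))
      \<union> complete_minus n (cycle_graph 4)
      \<union> complete_minus n (star_graph 3)" (is "G \<in> ?R")
proof -
  let ?N = "nonedges G" and ?T = "\<Union> (nonedges G)"
  define good where "good w x y z \<longleftrightarrow> distinct [w, x, y, z] \<and> ?T = {w, x, y, z}" for w x y z
  note labelled = complete_minus_if_labelled[OF G, folded n]
  have sub: "{w, x, y, z} \<subseteq> verts G" if "good w x y z" for w x y z
    using that Union_nonedges_subset[of G] by (simp add: good_def)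
  have P4: "G \<in> ?R" if "good w x y z" "?N = {{w, x}, {x, y}, {y, z}}" for w x y z
  proof -
    have "G \<in> complete_minus n (path_graph 4)"
      by (rule labelled[OF _ sub[OF that(1)]]) (use that in \<open>simp_all add: good_def path_graph_4\<close>)
    then show ?thesis by blast
  qed
  have K2: "G \<in> ?R" if "good w x y z" "?N = {{w, x}, {y, z}}" for w x y z
  proof -
    have "G \<in> complete_minus n two_K2"
      by (rule labelled[OF _ sub[OF that(1)]]) (use that in \<open>simp_all add: good_def two_K2_def\<close>)
    then show ?thesis by blast
  qed
  have K4: "G \<in> ?R" if "good w x y z" "?N = {{w, x}, {w, y}, {w, z}, {x, y}, {x, z}, {y, z}}"
    for w x y z
  proof -
    have "G \<in> complete_minus n (complete_graph 4)"
      by (rule labelled[OF _ sub[OF that(1)]]) (use that in \<open>simp_all add: good_def complete_graph_4\<close>)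
    then show ?thesis by blast
  qed
  have dia: "G \<in> ?R" if "good w x y z" "?N = {{w, y}, {w, z}, {x, y}, {x, z}, {y, z}}" for w x y z
  proof -
    have "G \<in> complete_minus n diamond"
      by (rule labelled[OF _ sub[OF that(1)]]) (use that in \<open>simp_all add: good_def diamond_def\<close>)
    then show ?thesis using diamond_in by (auto simp: complete_minus_class_def)
  qed
  have paw: "G \<in> ?R" if "good w x y z" "?N = {{w, y}, {w, z}, {x, z}, {y, z}}" for w x y z
  proof -
    have "G \<in> complete_minus n paw"
      by (rule labelled[OF _ sub[OF that(1)]]) (use that in \<open>simp_all add: good_def paw_def\<close>)
    then show ?thesis using paw_in by (auto simp: complete_minus_class_def)
  qed
  have C4: "G \<in> ?R" if "good w x y z" "?N = {{w, x}, {x, y}, {y, z}, {z, w}}" for w x y z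
  proof -
    have "G \<in> complete_minus n (cycle_graph 4)"
      by (rule labelled[OF _ sub[OF that(1)]]) (use that in \<open>simp_all add: good_def cycle_graph_4\<close>)
    then show ?thesis by blast
  qed
  have star: "G \<in> ?R" if "good w x y z" "?N = {{w, x}, {w, y}, {w, z}}" for w x y z
  proof -
    have "G \<in> complete_minus n (star_graph 3)"
      by (rule labelled[OF _ sub[OF that(1)]]) (use that in \<open>simp_all add: good_def star_graph_3\<close>)
    then show ?thesis by blast
  qed
  have N6: "?N \<subseteq> {{w, x}, {w, y}, {w, z}, {x, y}, {x, z}, {y, z}}" if g: "good w x y z" for w x y z
  proof -
    from g have "distinct [w, x, y, z]" "?T = {w, x, y, z}" by (simp_all add: good_def)
    then have "?N \<subseteq> {e. e \<subseteq> {w, x, y, z} \<and> card e = 2}" by (auto simp: nonedges_def)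
    then show ?thesis using pairs_of_four[OF \<open>distinct [w, x, y, z]\<close>] by simp
  qed
  have matching: "G \<in> ?R" if g: "good w x y z" and m: "{w, x} \<in> ?N" "{y, z} \<in> ?N" for w x y z
  proof -
    have N: "?N = {{w, x}, {y, z}} \<union> (if {w, y} \<in> ?N then {{w, y}} else {})
        \<union> (if {w, z} \<in> ?N then {{w, z}} else {}) \<union> (if {x, y} \<in> ?N then {{x, y}} else {})
        \<union> (if {x, z} \<in> ?N then {{x, z}} else {})" (is "_ = ?M")
    proof
      show "?N \<subseteq> ?M"
      proof
        fix e assume e: "e \<in> ?N"
        with N6[OF g] have "e \<in> {{w, x}, {w, y}, {w, z}, {x, y}, {x, z}, {y, z}}" by blast
        with e show "e \<in> ?M" by auto
      qed
      show "?M \<subseteq> ?N" using m by (simp split: if_split)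
    qed
    \<comment> \<open>Relabellings that bring the sixteen cases into the normal forms
      \<open>P4\<close> to \<open>C4\<close> above.\<close>
    have perm: "good x w y z" "good x w z y" "good w x z y" "good y x z w" "good y w z x"
      "good w z x y" "good w y x z" "good x y w z" "good x z w y"
      using g unfolding good_def by auto
    show ?thesis
    proof (cases "{w, y} \<in> ?N"; cases "{w, z} \<in> ?N"; cases "{x, y} \<in> ?N"; cases "{x, z} \<in> ?N")
      assume b: "{w, y} \<in> ?N" "{w, z} \<in> ?N" "{x, y} \<in> ?N" "{x, z} \<in> ?N"
      show ?thesis by (rule K4[OF g]) (subst N, simp add: b, simp add: insert_commute)
    next
      assume b: "{w, y} \<in> ?N" "{w, z} \<in> ?N" "{x, y} \<in> ?N" "{x, z} \<notin> ?N"
      show ?thesis by (rule dia[OF perm(9)]) (subst N, simp add: b, simp add: insert_commute)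
    next
      assume b: "{w, y} \<in> ?N" "{w, z} \<in> ?N" "{x, y} \<notin> ?N" "{x, z} \<in> ?N"
      show ?thesis by (rule dia[OF perm(8)]) (subst N, simp add: b, simp add: insert_commute)
    next
      assume b: "{w, y} \<in> ?N" "{w, z} \<in> ?N" "{x, y} \<notin> ?N" "{x, z} \<notin> ?N"
      show ?thesis by (rule paw[OF perm(4)]) (subst N, simp add: b, simp add: insert_commute)
    next
      assume b: "{w, y} \<in> ?N" "{w, z} \<notin> ?N" "{x, y} \<in> ?N" "{x, z} \<in> ?N"
      show ?thesis by (rule dia[OF perm(6)]) (subst N, simp add: b, simp add: insert_commute)
    next
      assume b: "{w, y} \<in> ?N" "{w, z} \<notin> ?N" "{x, y} \<in> ?N" "{x, z} \<notin> ?N"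
      show ?thesis by (rule paw[OF perm(6)]) (subst N, simp add: b, simp add: insert_commute)
    next
      assume b: "{w, y} \<in> ?N" "{w, z} \<notin> ?N" "{x, y} \<notin> ?N" "{x, z} \<in> ?N"
      show ?thesis by (rule C4[OF perm(3)]) (subst N, simp add: b, simp add: insert_commute)
    next
      assume b: "{w, y} \<in> ?N" "{w, z} \<notin> ?N" "{x, y} \<notin> ?N" "{x, z} \<notin> ?N"
      show ?thesis by (rule P4[OF perm(1)]) (subst N, simp add: b, simp add: insert_commute)
    next
      assume b: "{w, y} \<notin> ?N" "{w, z} \<in> ?N" "{x, y} \<in> ?N" "{x, z} \<in> ?N"
      show ?thesis by (rule dia[OF perm(7)]) (subst N, simp add: b, simp add: insert_commute)
    next
      assume b: "{w, y} \<notin> ?N" "{w, z} \<in> ?N" "{x, y} \<in> ?N" "{x, z} \<notin> ?N"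
      show ?thesis by (rule C4[OF g]) (subst N, simp add: b, simp add: insert_commute)
    next
      assume b: "{w, y} \<notin> ?N" "{w, z} \<in> ?N" "{x, y} \<notin> ?N" "{x, z} \<in> ?N"
      show ?thesis by (rule paw[OF perm(7)]) (subst N, simp add: b, simp add: insert_commute)
    next
      assume b: "{w, y} \<notin> ?N" "{w, z} \<in> ?N" "{x, y} \<notin> ?N" "{x, z} \<notin> ?N"
      show ?thesis by (rule P4[OF perm(2)]) (subst N, simp add: b, simp add: insert_commute)
    next
      assume b: "{w, y} \<notin> ?N" "{w, z} \<notin> ?N" "{x, y} \<in> ?N" "{x, z} \<in> ?N"
      show ?thesis by (rule paw[OF perm(5)]) (subst N, simp add: b, simp add: insert_commute)
    next
      assume b: "{w, y} \<notin> ?N" "{w, z} \<notin> ?N" "{x, y} \<in> ?N" "{x, z} \<notin> ?N"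
      show ?thesis by (rule P4[OF g]) (subst N, simp add: b, simp add: insert_commute)
    next
      assume b: "{w, y} \<notin> ?N" "{w, z} \<notin> ?N" "{x, y} \<notin> ?N" "{x, z} \<in> ?N"
      show ?thesis by (rule P4[OF perm(3)]) (subst N, simp add: b, simp add: insert_commute)
    next
      assume b: "{w, y} \<notin> ?N" "{w, z} \<notin> ?N" "{x, y} \<notin> ?N" "{x, z} \<notin> ?N"
      show ?thesis by (rule K2[OF g]) (subst N, simp add: b)
    qed
  qed
  have "?T \<noteq> {}" using T by (metis card.empty zero_neq_numeral)
  then obtain a where a: "a \<in> ?T" by blast
  then obtain p where ap: "{a, p} \<in> ?N" unfolding mem_Union_nonedges_iff by blast
  then have p: "p \<in> ?T" "p \<noteq> a" using pair_in_nonedges_iff[of a p G] by blast+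
  have "card (?T - {a, p}) = 2" using a p T card_Diff_subset[of "{a, p}" ?T] by simp
  then obtain q r where qr: "?T - {a, p} = {q, r}" "q \<noteq> r" unfolding card_2_iff by blast
  have "?T = insert a (insert p (?T - {a, p}))" using a p by blast
  then have "?T = {a, p, q, r}" unfolding qr(1) .
  moreover have "q \<notin> {a, p}" "r \<notin> {a, p}" using qr(1) by blast+
  ultimately have good: "good a p q r" using p qr(2) by (auto simp: good_def)
  then have perm: "good q a r p" "good q p r a" "good p a q r" by (auto simp: good_def)
  have pa: "{p, a} \<in> ?N" using ap by (simp add: insert_commute)
  have nb: "\<exists>y \<in> {a, p, q, r} - {x}. {x, y} \<in> ?N" if "x \<in> ?T" for x
  proof -
    from that obtain y where y: "{x, y} \<in> ?N" unfolding mem_Union_nonedges_iff by blast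
    then have "y \<in> ?T" by blast
    moreover have "y \<noteq> x" using y unfolding pair_in_nonedges_iff by blast
    ultimately show ?thesis using y good unfolding good_def by blast
  qed
  show ?thesis
  \<comment> \<open>These are the three perfect matchings on \<open>a\<close>, \<open>p\<close>,
    \<open>q\<close>, \<open>r\<close>; the first uses the known non-edge
    \<open>{a, p}\<close>.\<close>
  proof (cases "{q, r} \<in> ?N \<or> {q, a} \<in> ?N \<and> {r, p} \<in> ?N \<or> {q, p} \<in> ?N \<and> {r, a} \<in> ?N")
    case True
    then show ?thesis
      using matching[OF good ap] matching[OF perm(1)] matching[OF perm(2)] by blast
  next
    case False
    have q: "{q, a} \<in> ?N \<or> {q, p} \<in> ?N"
      using nb[of q] False good by (auto simp: good_def)
    have r: "{r, a} \<in> ?N \<or> {r, p} \<in> ?N"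
      using nb[of r] False good by (auto simp: good_def insert_commute)
    \<comment> \<open>Without a perfect matching, \<open>q\<close> and \<open>r\<close> cannot
      attach to different ends of \<open>{a, p}\<close>, so their common neighbor is the center of a
      star.\<close>
    from q show ?thesis
    proof
      assume qa: "{q, a} \<in> ?N"
      with False r have "{r, a} \<in> ?N" "{r, p} \<notin> ?N" "{q, p} \<notin> ?N" "{q, r} \<notin> ?N" by auto
      with qa ap N6[OF good] have "?N = {{a, p}, {a, q}, {a, r}}"
        by (auto simp: insert_commute)
      with good show ?thesis by (rule star)
    next
      assume qp: "{q, p} \<in> ?N"
      with False r have "{r, p} \<in> ?N" "{r, a} \<notin> ?N" "{q, a} \<notin> ?N" "{q, r} \<notin> ?N" by auto
      with qp pa N6[OF perm(3)] have "?N = {{p, a}, {p, q}, {p, r}}"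
        by (auto simp: insert_commute)
      with perm(3) show ?thesis by (rule star)
    qed
  qed
qed

theorem theorem9:
  fixes G :: "'a ugraph" and n m :: nat
  assumes "simple_graph G"
    and "connected_graph G"
    and "n = card (verts G)"
    and "m = card (edges G)"
  shows "int (tmc G) = int m + int n - 4 \<longleftrightarrow>
    G \<in> complete_minus n (path_graph 4)
      \<union> complete_minus n two_K2
      \<union> complete_minus n (complete_graph 4)
      \<union> complete_minus_class n (complete_minus 4 (complete_graph 2))
      \<union> complete_minus_class n (complete_minus 4 (path_graph 3))
      \<union> complete_minus n (cycle_graph 4)
      \<union> complete_minus n (star_graph 3)"
    (is "_ \<longleftrightarrow> G \<in> ?R")
proof -
  have "int (tmc G) = int m + int n - 4 \<longleftrightarrow> tmc G + 4 = card (verts G) + card (edges G)"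
    using assms(3,4) by linarith
  also have "\<dots> \<longleftrightarrow> card (\<Union> (nonedges G)) = 4"
    by (rule tmc_eq_iff_card_nonuniversal[OF assms(1,2)])
  also have "\<dots> \<longleftrightarrow> G \<in> ?R"
  proof
    assume "card (\<Union> (nonedges G)) = 4"
    then show "G \<in> ?R" by (rule complete_minus_if_four_nonuniversal[OF assms(1) _ assms(3)])
  next
    have K: "card (\<Union> (nonedges G)) = 4"
      if "G \<in> complete_minus n H" "\<Union> (edges H) = verts H" "card (verts H) = 4" for H
      using card_Union_nonedges_complete_minus[OF that(1,2)] that(3) by simp
    \<comment> \<open>For the two iterated deletions \<open>H\<close> is an arbitrary member of its
      class, so it cannot be evaluated explicitly as in the five other cases.\<close>
    have KC: "card (\<Union> (nonedges G)) = 4"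
      if G: "G \<in> complete_minus_class n (complete_minus 4 K)"
        and "finite (edges K)" "card (edges K) \<le> 2" for K
    proof -
      from G obtain H where H: "H \<in> complete_minus 4 K" "G \<in> complete_minus n H"
        by (auto simp: complete_minus_class_def)
      show ?thesis
        by (rule K[OF H(2)]) (rule Union_edges_complete_minus_4[OF H(1) that(2,3)])+
    qed
    assume "G \<in> ?R"
    then show "card (\<Union> (nonedges G)) = 4"
      by (elim UnE)
        (erule K KC; auto simp: path_graph_4 two_K2_def complete_graph_4 cycle_graph_4
          star_graph_3 complete_graph_2 path_graph_3 card_insert_if)+
  qed
  finally show ?thesis .
qed

end
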